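(* There is a unique non-trivial increasing solution to the complementary pair problem for $\alpha=\sqrt2$, normalized by $V(1)=1$. That is, among all sextuples of integers $(p,q,r,s,t,u)$ with $p\ne0$ and $s\neq 0$, the sequences $V(n)=p\lfloor n\sqrt2\rfloor+qn+r$ and $W(n)=s\lfloor n\sqrt2\rfloor+tn+u$ ($n\ge1$) are increasing, complementary and satisfy $V(1)=1$ if and only if $(p,q,r,s,t,u)=(1,0,0,1,2,0)$.
   Context: Two sequences $V=(V(n))_{n\ge1}$, $W=(W(n))_{n\ge1}$ of positive integers are complementary if the sets $\{V(n):n\ge1\}$ and $\{W(n):n\ge1\}$ are disjoint and their union is the set of positive integers. The complementary pair problem for $\alpha$ asks for all sextuples of integers $(p,q,r,s,t,u)$ such that $V(n)=p\lfloor n\alpha\rfloor+qn+r$ and $W(n)=s\lfloor n\alpha\rfloor+tn+u$ ($n\ge 1$) are complementary. Sequences are required to be injective, so "increasing" means strictly increasing. A solution is trivial if $p=0$ or $s=0$. When $V$ and $W$ are increasing, one normalizes (by ordering the pair) so that $V(1)=1$. *)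

theory Defs
  imports Complex_Main
begin

(* Sequences are indexed by n >= 1; they are functions on nat whose value at 0 is ignored. *)

definition complementary :: "(nat \<Rightarrow> int) \<Rightarrow> (nat \<Rightarrow> int) \<Rightarrow> bool" where
  "complementary V W \<longleftrightarrow>
     (\<forall>n\<ge>1. V n > 0) \<and> (\<forall>n\<ge>1. W n > 0) \<and>
     V ` {1..} \<inter> W ` {1..} = {} \<and> V ` {1..} \<union> W ` {1..} = {k. k > 0}"

definition beatty_seq :: "real \<Rightarrow> int \<Rightarrow> int \<Rightarrow> int \<Rightarrow> nat \<Rightarrow> int" where
  "beatty_seq \<alpha> p q r n = p * \<lfloor>real n * \<alpha>\<rfloor> + q * int n + r"

definition complementary_pair_solution ::
    "real \<Rightarrow> int \<times> int \<times> int \<times> int \<times> int \<times> int \<Rightarrow> bool" where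
  "complementary_pair_solution \<alpha> = (\<lambda>(p, q, r, s, t, u).
     inj_on (beatty_seq \<alpha> p q r) {1..} \<and> inj_on (beatty_seq \<alpha> s t u) {1..} \<and>
     complementary (beatty_seq \<alpha> p q r) (beatty_seq \<alpha> s t u))"

definition increasing_solution ::
    "real \<Rightarrow> int \<times> int \<times> int \<times> int \<times> int \<times> int \<Rightarrow> bool" where
  "increasing_solution \<alpha> = (\<lambda>(p, q, r, s, t, u).
     complementary_pair_solution \<alpha> (p, q, r, s, t, u) \<and>
     strict_mono_on {1..} (beatty_seq \<alpha> p q r) \<and> strict_mono_on {1..} (beatty_seq \<alpha> s t u))"

end

theory Submission
  imports Defs
begin

text \<open>
  Write \<open>x = p \<alpha> + q\<close> and \<open>y = s \<alpha> + t\<close> for the slopes of \<open>V\<close> and \<open>W\<close>, where \<open>\<alpha> = sqrt 2\<close>.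
  Exactly \<open>V m - m\<close> terms of \<open>W\<close> lie below \<open>V m\<close>; comparing linear growth gives
  \<open>(x - 1) (y - 1) = 1\<close>. The increments of \<open>V\<close> are \<open>p + q\<close> and \<open>2 p + q\<close>, those of \<open>W\<close> are
  \<open>s + t\<close> and \<open>2 s + t\<close>, all positive. If all were at least 2, both slopes would exceed 2,
  so one increment equals 1, and irrationality of \<open>\<alpha>\<close> leaves only the slopes
  \<open>sqrt 2\<close> and \<open>2 + sqrt 2\<close>. The first few terms then fix the constants, and
  Beatty's theorem shows that the remaining candidate is a solution.
\<close>

section \<open>Irrationality of \<open>sqrt 2\<close>\<close>

text \<open>Infinite descent: both numbers are even, and halving them gives another solution with
  smaller \<open>\<bar>b\<bar>\<close> unless \<open>b = 0\<close>. This form allows comparing the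
  coefficients of 1 and \<open>sqrt 2\<close> in integer identities.\<close>

lemma sqrt2_combination_eq_0:
  fixes a b :: int
  assumes "of_int a + of_int b * sqrt 2 = 0"
  shows "a = 0 \<and> b = 0"
proof -
  have descent: "b = 0" if "a\<^sup>2 = 2 * b\<^sup>2" for a b :: int
    using that
  proof (induction "nat \<bar>b\<bar>" arbitrary: a b rule: less_induct)
    case less
    have "even a" using less.prems by (metis dvd_triv_left even_power)
    then obtain c where c: "a = 2 * c" by blast
    have b2: "b\<^sup>2 = 2 * c\<^sup>2" using less.prems c by (simp add: power_mult_distrib)
    then have "even b" by (metis dvd_triv_left even_power)
    then obtain d where d: "b = 2 * d" by blast
    have "c\<^sup>2 = 2 * d\<^sup>2" using b2 d by (simp add: power_mult_distrib)
    then show "b = 0" using less.hyps[of d c] d by (cases "d = 0") (simp_all add: abs_mult)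
  qed
  have "of_int a = - of_int b * sqrt 2" using assms by simp
  then have "(of_int a)\<^sup>2 = (2::real) * (of_int b)\<^sup>2" by (simp add: power_mult_distrib)
  then have "real_of_int (a\<^sup>2) = real_of_int (2 * b\<^sup>2)" by simp
  then have "a\<^sup>2 = 2 * b\<^sup>2" unfolding of_int_eq_iff .
  then have "b = 0" by (rule descent)
  then show ?thesis using assms by simp
qed

lemma sqrt2_irrational: "sqrt 2 \<notin> \<rat>"
proof
  assume "sqrt 2 \<in> \<rat>"
  then obtain a b :: int where "b > 0" "sqrt 2 = of_int a / of_int b"
    by (rule Rats_cases') auto
  then have "of_int (- a) + of_int b * sqrt 2 = 0" by simp
  then show False using sqrt2_combination_eq_0[of "- a" b] \<open>b > 0\<close> by blast
qed

section \<open>Beatty's theorem\<close>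

text \<open>Up to a real bound \<open>k\<close> there are about \<open>k / \<alpha>\<close>
  multiples of \<alpha> and \<open>k / \<beta>\<close> of \<beta>, together \<open>k\<close>. A
  value hit by both sequences, or by neither, would squeeze an integer strictly between two
  consecutive integers.\<close>

theorem beatty:
  fixes \<alpha> \<beta> :: real
  assumes irr: "\<alpha> \<notin> \<rat>" and pos: "\<alpha> > 0" "\<beta> > 0" and sum: "1 / \<alpha> + 1 / \<beta> = 1"
  shows "complementary (\<lambda>n. \<lfloor>real n * \<alpha>\<rfloor>) (\<lambda>n. \<lfloor>real n * \<beta>\<rfloor>)"
proof -
  have eq: "k / \<alpha> + k / \<beta> = k" for k
    using arg_cong[OF sum, of "\<lambda>z. k * z"] by (simp add: distrib_left)
  have "1 / \<alpha> < 1" "1 / \<beta> < 1" using sum pos by (smt (verit) divide_pos_pos)+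
  then have gt1: "\<alpha> > 1" "\<beta> > 1" using pos by (simp_all add: field_simps)
  have "\<beta> \<notin> \<rat>"
  proof
    assume "\<beta> \<in> \<rat>"
    then have "1 / (1 - 1 / \<beta>) \<in> \<rat>" by (intro Rats_divide Rats_diff Rats_1)
    moreover have "1 - 1 / \<beta> = 1 / \<alpha>" using sum by linarith
    ultimately show False using irr by simp
  qed
  \<comment> \<open>Irrationality keeps positive multiples off the integers, so the inequalities
    below are strict.\<close>
  have ne: "real n * \<gamma> \<noteq> of_int k" if "\<gamma> \<notin> \<rat>" "n \<ge> 1" for n k and \<gamma> :: real
  proof
    assume "real n * \<gamma> = of_int k"
    then have "\<gamma> = of_int k / of_nat n" using that(2) by (simp add: field_simps)
    then show False using that(1) by simp
  qed
  note ne = ne[OF irr] ne[OF \<open>\<beta> \<notin> \<rat>\<close>]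
  have ge1: "\<lfloor>real n * \<gamma>\<rfloor> > 0" if "\<gamma> > 1" "n \<ge> 1" for n and \<gamma> :: real
    using that mult_mono[of 1 "real n" 1 \<gamma>] by (simp add: le_floor_iff)
  have disjoint: "\<lfloor>real n * \<alpha>\<rfloor> \<noteq> \<lfloor>real m * \<beta>\<rfloor>" if nm: "n \<ge> 1" "m \<ge> 1" for n m
  proof
    assume e: "\<lfloor>real n * \<alpha>\<rfloor> = \<lfloor>real m * \<beta>\<rfloor>"
    define k where "k = \<lfloor>real n * \<alpha>\<rfloor>"
    have "of_int k < real n * \<alpha>" "real n * \<alpha> < of_int k + 1"
         "of_int k < real m * \<beta>" "real m * \<beta> < of_int k + 1"
      using ne(1)[of n k] ne(2)[of m k] nm e unfolding k_def by linarith+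
    then have "of_int k / \<alpha> < real n" "real n < (of_int k + 1) / \<alpha>"
         "of_int k / \<beta> < real m" "real m < (of_int k + 1) / \<beta>"
      using pos by (simp_all add: field_simps)
    then have "of_int k < real n + real m" "real n + real m < of_int k + 1"
      using eq[of "of_int k"] eq[of "of_int k + 1"] by linarith+
    \<comment> \<open>The integer \<open>n + m\<close> would lie strictly between \<open>k\<close>
      and \<open>k + 1\<close>.\<close>
    then have "real_of_int k < of_int (int n + int m)" "real_of_int (int n + int m) < of_int (k + 1)"
      by simp_all
    then show False unfolding of_int_less_iff by linarith
  qed
  \<comment> \<open>If \<open>k\<close> is missed, the interval from \<open>k\<close> to
    \<open>k + 1\<close> fits strictly between consecutive multiples. The lower multiple may be the
    zeroth, hence the separate use of \<open>k > 0\<close> below.\<close>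
  have last_below: "\<exists>n. real n * \<gamma> < of_int k \<and> of_int k + 1 < real (Suc n) * \<gamma>"
    if g: "\<gamma> > 1" "\<gamma> \<notin> \<rat>" and irr: "\<And>n k. n \<ge> 1 \<Longrightarrow> real n * \<gamma> \<noteq> of_int k"
      and k: "k > 0" "k \<notin> (\<lambda>n. \<lfloor>real n * \<gamma>\<rfloor>) ` {1..}" for \<gamma> :: real and k
  proof -
    define n where "n = nat \<lfloor>of_int k / \<gamma>\<rfloor>"
    have "of_int k / \<gamma> > 0" using g k by simp
    then have "real n \<le> of_int k / \<gamma>" "of_int k / \<gamma> < real (Suc n)"
      unfolding n_def by linarith+
    then have b: "real n * \<gamma> \<le> of_int k" "of_int k < real (Suc n) * \<gamma>"
      using g by (simp_all add: field_simps)
    have "\<lfloor>real (Suc n) * \<gamma>\<rfloor> \<noteq> k" using k(2) by (metis atLeast_iff image_eqI le_add1 plus_1_eq_Suc)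
    then have "of_int k + 1 \<le> real (Suc n) * \<gamma>" using b(2) by linarith
    moreover have "real (Suc n) * \<gamma> \<noteq> of_int (k + 1)" by (rule irr) simp
    moreover have "real n * \<gamma> \<noteq> of_int k" using irr[of n k] k(1) by (cases n) auto
    ultimately show ?thesis using b(1) by (intro exI[of _ n]) auto
  qed
  have cover: "k \<in> (\<lambda>n. \<lfloor>real n * \<alpha>\<rfloor>) ` {1..} \<union> (\<lambda>n. \<lfloor>real n * \<beta>\<rfloor>) ` {1..}" if "k > 0" for k
  proof (rule ccontr)
    assume "\<not> ?thesis"
    then have "k \<notin> (\<lambda>n. \<lfloor>real n * \<alpha>\<rfloor>) ` {1..}" "k \<notin> (\<lambda>n. \<lfloor>real n * \<beta>\<rfloor>) ` {1..}" by blast+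
    from last_below[OF gt1(1) irr ne(1) that this(1)] last_below[OF gt1(2) \<open>\<beta> \<notin> \<rat>\<close> ne(2) that this(2)]
    obtain n m where
      "real n * \<alpha> < of_int k" "of_int k + 1 < real (Suc n) * \<alpha>"
      "real m * \<beta> < of_int k" "of_int k + 1 < real (Suc m) * \<beta>"
      by blast
    then have "real n < of_int k / \<alpha>" "(of_int k + 1) / \<alpha> < real (Suc n)"
      "real m < of_int k / \<beta>" "(of_int k + 1) / \<beta> < real (Suc m)"
      using pos by (simp_all add: field_simps)
    then have "real n + real m < of_int k" "of_int k + 1 < real (Suc n) + real (Suc m)"
      using eq[of "of_int k"] eq[of "of_int k + 1"] by linarith+
    \<comment> \<open>Here \<open>n + m\<close> would lie strictly between \<open>k - 1\<close> and
      \<open>k\<close>.\<close>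
    then have "real_of_int (int n + int m) < of_int k" "real_of_int (k + 1) < of_int (int n + int m + 2)"
      by simp_all
    then show False unfolding of_int_less_iff by linarith
  qed
  show ?thesis
    unfolding complementary_def
  proof (intro conjI)
    show "(\<lambda>n. \<lfloor>real n * \<alpha>\<rfloor>) ` {1..} \<union> (\<lambda>n. \<lfloor>real n * \<beta>\<rfloor>) ` {1..} = {k. k > 0}"
      using cover ge1 gt1 by (auto simp only: Un_iff image_iff mem_Collect_eq atLeast_iff)
  qed (use disjoint ge1 gt1 in auto)
qed

section \<open>Counting terms and the relation between the slopes\<close>

text \<open>The integers from 1 to \<open>V m\<close> split into the first \<open>m\<close> terms of
  \<open>V\<close> and the terms of \<open>W\<close> below \<open>V m\<close>; \<open>n\<close>
  counts the latter. The guard \<open>n \<ge> 1\<close> is there because index 0 is not part of the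
  sequence.\<close>

lemma complementary_rank:
  assumes compl: "complementary V W"
    and V: "strict_mono_on {1..} V" and W: "strict_mono_on {1..} W" and m: "m \<ge> 1"
  obtains n where "V m = int (m + n)" "n \<ge> 1 \<Longrightarrow> W n < V m" "V m < W (Suc n)"
proof -
  have pos: "V n > 0" "W n > 0" and disj: "V n \<noteq> W k" if "n \<ge> 1" "k \<ge> 1" for n k
    using compl that unfolding complementary_def by fastforce+
  define J where "J = {j. j \<ge> 1 \<and> W j < V m}"
  have injV: "inj_on V {1..m}" and injW: "inj_on W J"
    using strict_mono_on_imp_inj_on[OF V] strict_mono_on_imp_inj_on[OF W]
    by (auto intro: inj_on_subset simp: J_def)
  have WJ: "W ` J \<subseteq> {1..V m}"
  proof
    fix k assume "k \<in> W ` J"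
    then obtain j where "j \<ge> 1" "k = W j" "W j < V m" by (auto simp: J_def)
    then show "k \<in> {1..V m}" using pos(2)[of j j] by simp
  qed
  then have finJ: "finite J" using injW by (meson finite_atLeastAtMost_int finite_imageD finite_subset)
  have VI: "V ` {1..m} \<subseteq> {1..V m}"
  proof
    fix k assume "k \<in> V ` {1..m}"
    then obtain i where i: "1 \<le> i" "i \<le> m" "k = V i" by auto
    then have "V i \<le> V m" by (intro strict_mono_on_leD[OF V]) auto
    then show "k \<in> {1..V m}" using i pos(1)[of i i] by simp
  qed
  have "{1..V m} \<subseteq> V ` {1..m} \<union> W ` J"
  proof
    fix k assume k: "k \<in> {1..V m}"
    then have "k \<in> V ` {1..} \<union> W ` {1..}" using compl by (simp add: complementary_def)
    then consider i where "i \<ge> 1" "k = V i" | j where "j \<ge> 1" "k = W j" by auto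
    then show "k \<in> V ` {1..m} \<union> W ` J"
    proof cases
      case 1
      have "i \<le> m"
      proof (rule ccontr)
        assume "\<not> i \<le> m"
        then have "V m < V i" using m by (intro strict_mono_onD[OF V]) auto
        then show False using k 1 by simp
      qed
      then show ?thesis using 1 by auto
    next
      case 2
      then have "W j < V m" using disj[OF m, of j] k by simp
      then show ?thesis using 2 by (simp add: J_def)
    qed
  qed
  then have "{1..V m} = V ` {1..m} \<union> W ` J" using VI WJ by blast
  moreover have "V ` {1..m} \<inter> W ` J = {}" using disj unfolding J_def by auto
  ultimately have "card {1..V m} = m + card J"
    using finJ injV injW by (simp add: card_Un_disjoint card_image)
  moreover have "V m > 0" using pos(1) m by simp
  ultimately have 1: "V m = int (m + card J)" by simp
  \<comment> \<open>Since \<open>J\<close> is an initial segment of the positive indices, its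
    cardinality is also its last index.\<close>
  have down: "i \<in> J" if j: "j \<in> J" "1 \<le> i" "i \<le> j" for i j
  proof -
    have "W i \<le> W j" using j by (intro strict_mono_on_leD[OF W]) auto
    then show ?thesis using j by (simp add: J_def)
  qed
  have "card J \<in> J" if "card J \<ge> 1"
  proof (rule ccontr)
    assume "card J \<notin> J"
    have "J \<subseteq> {1..<card J}"
    proof
      fix j assume j: "j \<in> J"
      then have "\<not> card J \<le> j" using down[OF j that] \<open>card J \<notin> J\<close> by blast
      then show "j \<in> {1..<card J}" using j by (simp add: J_def)
    qed
    then have "card J \<le> card {1..<card J}" by (intro card_mono) auto
    then show False using that by simp
  qed
  then have 2: "W (card J) < V m" if "card J \<ge> 1" using that by (simp add: J_def)
  have "Suc (card J) \<notin> J"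
  proof
    assume "Suc (card J) \<in> J"
    then have "{1..Suc (card J)} \<subseteq> J" using down by auto
    from card_mono[OF finJ this] show False by simp
  qed
  moreover have "V m \<noteq> W (Suc (card J))" using disj m by simp
  ultimately have "V m < W (Suc (card J))" by (simp add: J_def)
  then show thesis using that 1 2 by blast
qed

lemma beatty_seq_linear_bound:
  "\<bar>of_int (beatty_seq \<alpha> p q r n) - (of_int p * \<alpha> + of_int q) * real n\<bar> \<le> \<bar>of_int p\<bar> + \<bar>of_int r\<bar>"
proof -
  have "of_int (beatty_seq \<alpha> p q r n) - (of_int p * \<alpha> + of_int q) * real n
      = of_int r - of_int p * frac (real n * \<alpha>)"
    by (simp add: beatty_seq_def frac_def algebra_simps)
  moreover have "\<bar>of_int p * frac (real n * \<alpha>)\<bar> \<le> \<bar>of_int p\<bar>"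
    by (simp add: abs_mult frac_ge_0 less_imp_le frac_lt_1 mult_left_le)
  ultimately show ?thesis by linarith
qed

lemma bounded_multiples_imp_zero:
  fixes a C :: real
  assumes "\<And>m::nat. m \<ge> 1 \<Longrightarrow> \<bar>a * real m\<bar> \<le> C"
  shows "a = 0"
proof (rule ccontr)
  assume "a \<noteq> 0"
  then obtain m :: nat where m: "C < real m * \<bar>a\<bar>" using reals_Archimedean3[of "\<bar>a\<bar>"] by auto
  have "C \<ge> 0" using assms[of 1] by simp
  then have "m \<ge> 1" using m by (cases m) auto
  then show False using assms[of m] m by (simp add: abs_mult mult.commute)
qed

text \<open>With \<open>n = V m - m\<close>, the term \<open>V m\<close> lies between consecutive
  terms of \<open>W\<close>, so it differs from \<open>Y * n\<close> by a bounded amount, as it does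
  from \<open>X * m\<close>. Eliminating \<open>n\<close> and \<open>V m\<close> leaves a bounded
  linear function of \<open>m\<close>, whose coefficient must vanish.\<close>

lemma complementary_slopes:
  fixes \<alpha> :: real
  defines "x \<equiv> \<lambda>p q. of_int p * \<alpha> + of_int q"
  assumes compl: "complementary (beatty_seq \<alpha> p q r) (beatty_seq \<alpha> s t u)"
    and V: "strict_mono_on {1..} (beatty_seq \<alpha> p q r)"
    and W: "strict_mono_on {1..} (beatty_seq \<alpha> s t u)"
  shows "(x p q - 1) * (x s t - 1) = 1"
proof -
  define V where "V = beatty_seq \<alpha> p q r"
  define W where "W = beatty_seq \<alpha> s t u"
  define X where "X = x p q"
  define Y where "Y = x s t"
  define A where "A = \<bar>real_of_int p\<bar> + \<bar>of_int r\<bar>"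
  define B where "B = \<bar>real_of_int s\<bar> + \<bar>of_int u\<bar>"
  have bV: "\<bar>of_int (V n) - X * real n\<bar> \<le> A" and bW: "\<bar>of_int (W n) - Y * real n\<bar> \<le> B" for n
    unfolding V_def W_def X_def Y_def x_def A_def B_def by (rule beatty_seq_linear_bound)+
  have "\<bar>((Y - 1) * X - Y) * real m\<bar> \<le> B + \<bar>Y\<bar> + \<bar>Y - 1\<bar> * A" if m: "m \<ge> 1" for m
  proof -
    obtain n where n: "V m = int (m + n)" "n \<ge> 1 \<Longrightarrow> W n < V m" "V m < W (Suc n)"
      using complementary_rank[OF compl V W m] unfolding V_def W_def by blast
    have "B \<ge> 0" by (simp add: B_def)
    have "Y * real n \<le> of_int (V m) + B"
    proof (cases "n \<ge> 1")
      case True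
      then have "real_of_int (W n) < of_int (V m)" using n(2) by simp
      then show ?thesis using bW[of n] by linarith
    next
      \<comment> \<open>No term of \<open>W\<close> precedes \<open>V m\<close>, but then the left
        side is 0 and \<open>V m = m\<close>.\<close>
      case False
      then have "n = 0" by simp
      then show ?thesis using \<open>B \<ge> 0\<close> n(1) by simp
    qed
    moreover have "of_int (V m) \<le> Y * real n + \<bar>Y\<bar> + B"
    proof -
      have "real_of_int (V m) < of_int (W (Suc n))" using n(3) by simp
      moreover have "Y * real (Suc n) = Y * real n + Y" by (simp add: algebra_simps)
      ultimately show ?thesis using bW[of "Suc n"] by linarith
    qed
    ultimately have b1: "\<bar>Y * real n - of_int (V m)\<bar> \<le> B + \<bar>Y\<bar>" by linarith
    have rn: "real n = of_int (V m) - real m" using n(1) by simp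
    have "((Y - 1) * X - Y) * real m
        = (Y * real n - of_int (V m)) - (Y - 1) * (of_int (V m) - X * real m)"
      unfolding rn by (simp add: algebra_simps)
    moreover have "\<bar>(Y - 1) * (of_int (V m) - X * real m)\<bar> \<le> \<bar>Y - 1\<bar> * A"
      using bV[of m] by (simp add: abs_mult mult_left_mono)
    ultimately show ?thesis using b1 by linarith
  qed
  then have "(Y - 1) * X - Y = 0" by (rule bounded_multiples_imp_zero)
  then show ?thesis by (simp add: X_def Y_def algebra_simps)
qed

section \<open>Integer constraints on the slopes\<close>

text \<open>As \<open>sqrt 2\<close> lies strictly between 1 and 2, the slope lies strictly between
  the two increments, which differ because \<open>s \<noteq> 0\<close>.\<close>

lemma slope_gt_2:
  fixes s t :: int
  assumes "s \<noteq> 0" "s + t \<ge> 2" "2 * s + t \<ge> 2"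
  shows "of_int s * sqrt 2 + of_int t > 2"
proof -
  have sq: "1 < sqrt 2" "sqrt 2 < 2" by (auto intro: real_less_lsqrt)
  have i: "real_of_int s + of_int t \<ge> 2" "2 * real_of_int s + of_int t \<ge> 2"
    using assms(2,3) by linarith+
  consider "real_of_int s > 0" | "real_of_int s < 0" using assms(1) by force
  then show ?thesis
  proof cases
    case 1
    then have "real_of_int s * 1 < of_int s * sqrt 2" using sq by (intro mult_strict_left_mono) auto
    then show ?thesis using i by linarith
  next
    case 2
    then have "real_of_int s * 2 < of_int s * sqrt 2" using sq by (intro mult_strict_left_mono_neg) auto
    then show ?thesis using i by linarith
  qed
qed

text \<open>The equations \<open>e\<close> are the coefficients of \<open>sqrt 2\<close> and 1 in
  \<open>x * y = x + y\<close>, for the slopes \<open>x\<close> of \<open>V\<close> and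
  \<open>y\<close> of \<open>W\<close>. Eliminating \<open>t\<close> and then \<open>q\<close>
  leaves \<open>p * s = 1\<close> if \<open>s + t = 1\<close>, and a parity contradiction if
  \<open>2 * s + t = 1\<close>.\<close>

lemma slopes_of_increment_1:
  fixes p q s t :: int
  assumes "s \<noteq> 0" and inc: "p + q \<ge> 1" "s + t = 1 \<or> 2 * s + t = 1"
    and e: "p + s = p * t + q * s" "q + t = 2 * p * s + q * t"
  shows "p = 1 \<and> q = 2 \<and> s = 1 \<and> t = 0"
  using inc(2)
proof
  assume "s + t = 1"
  then have t: "t = 1 - s" by simp
  have "s * (q - p - 1) = 0" using e(1) unfolding t by (simp add: algebra_simps)
  then have q: "q = p + 1" using \<open>s \<noteq> 0\<close> by simp
  have "p * s = 1" using e(2) unfolding t q by (simp add: algebra_simps)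
  then have "p = 1 \<and> s = 1 \<or> p = - 1 \<and> s = - 1" by (simp add: zmult_eq_1_iff)
  then show ?thesis using q t inc(1) by auto
next
  assume "2 * s + t = 1"
  then have t: "t = 1 - 2 * s" by simp
  have "s * (q - 2 * p - 1) = 0" using e(1) unfolding t by (simp add: algebra_simps)
  then have q: "q = 2 * p + 1" using \<open>s \<noteq> 0\<close> by simp
  have "2 * (p * s) = - 1" using e(2) unfolding t q by (simp add: algebra_simps)
  then have False by presburger
  then show ?thesis ..
qed

section \<open>Existence and uniqueness for \<open>sqrt 2\<close>\<close>

lemma floor_multiples_sqrt2:
  "\<lfloor>sqrt 2\<rfloor> = 1" "\<lfloor>2 * sqrt 2\<rfloor> = 2" "\<lfloor>3 * sqrt 2\<rfloor> = 4" "\<lfloor>5 * sqrt 2\<rfloor> = 7"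
proof -
  \<comment> \<open>The lower bound is what \<open>5 * sqrt 2 > 7\<close> requires, the upper one
    what \<open>2 * sqrt 2 < 3\<close> requires.\<close>
  have "7 / 5 < sqrt 2" "sqrt 2 < 3 / 2"
    by (rule real_less_rsqrt real_less_lsqrt; simp add: power2_eq_square)+
  then show "\<lfloor>sqrt 2\<rfloor> = 1" "\<lfloor>2 * sqrt 2\<rfloor> = 2" "\<lfloor>3 * sqrt 2\<rfloor> = 4" "\<lfloor>5 * sqrt 2\<rfloor> = 7"
    by linarith+
qed

lemma beatty_seq_sqrt2_values:
  "beatty_seq (sqrt 2) p q r 1 = p + q + r"
  "beatty_seq (sqrt 2) p q r 2 = 2 * p + 2 * q + r"
  "beatty_seq (sqrt 2) p q r 3 = 4 * p + 3 * q + r"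
  "beatty_seq (sqrt 2) p q r 5 = 7 * p + 5 * q + r"
  by (simp_all add: beatty_seq_def floor_multiples_sqrt2)

lemma strict_mono_beatty_seq:
  assumes "\<alpha> \<ge> 1" "p \<ge> 1" "q \<ge> 0"
  shows "strict_mono (beatty_seq \<alpha> p q r)"
proof (rule strict_mono_Suc_iff[THEN iffD2], rule allI)
  fix n
  have "\<lfloor>real n * \<alpha>\<rfloor> + 1 \<le> \<lfloor>real (Suc n) * \<alpha>\<rfloor>"
    using assms(1) by (simp add: le_floor_iff algebra_simps) linarith
  then have "p * (\<lfloor>real n * \<alpha>\<rfloor> + 1) \<le> p * \<lfloor>real (Suc n) * \<alpha>\<rfloor>"
    using assms(2) by (intro mult_left_mono) auto
  then show "beatty_seq \<alpha> p q r n < beatty_seq \<alpha> p q r (Suc n)"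
    using assms(2,3) unfolding beatty_seq_def by (simp add: algebra_simps)
qed

text \<open>This is Beatty's theorem for \<open>sqrt 2\<close> and \<open>sqrt 2 + 2\<close>; the
  integer \<open>2 * n\<close> moves out of the floor.\<close>

lemma sqrt2_solution: "increasing_solution (sqrt 2) (1, 0, 0, 1, 2, 0)"
proof -
  have 1: "beatty_seq (sqrt 2) 1 0 0 = (\<lambda>n. \<lfloor>real n * sqrt 2\<rfloor>)"
    by (simp add: beatty_seq_def fun_eq_iff)
  have 2: "beatty_seq (sqrt 2) 1 2 0 = (\<lambda>n. \<lfloor>real n * (sqrt 2 + 2)\<rfloor>)"
  proof
    fix n
    have "real n * (sqrt 2 + 2) = real n * sqrt 2 + of_int (2 * int n)"
      by (simp add: algebra_simps)
    then have "\<lfloor>real n * (sqrt 2 + 2)\<rfloor> = \<lfloor>real n * sqrt 2\<rfloor> + 2 * int n"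
      by (simp only: floor_add_int)
    then show "beatty_seq (sqrt 2) 1 2 0 n = \<lfloor>real n * (sqrt 2 + 2)\<rfloor>"
      by (simp add: beatty_seq_def)
  qed
  have "sqrt 2 + 2 > 0" by (simp add: add_pos_pos)
  then have "1 / sqrt 2 + 1 / (sqrt 2 + 2) = 1"
    by (simp add: divide_simps) (simp add: algebra_simps)
  then have "complementary (beatty_seq (sqrt 2) 1 0 0) (beatty_seq (sqrt 2) 1 2 0)"
    unfolding 1 2 using \<open>sqrt 2 + 2 > 0\<close> by (intro beatty sqrt2_irrational) auto
  moreover have "strict_mono (beatty_seq (sqrt 2) 1 0 0)" "strict_mono (beatty_seq (sqrt 2) 1 2 0)"
    by (simp_all add: strict_mono_beatty_seq)
  ultimately show ?thesis
    by (simp add: increasing_solution_def complementary_pair_solution_def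
        strict_mono_imp_inj_on monotone_on_subset[of UNIV])
qed

lemma sqrt2_solution_slopes:
  fixes p q r s t u :: int
  assumes "p \<noteq> 0" and "s \<noteq> 0" and sol: "increasing_solution (sqrt 2) (p, q, r, s, t, u)"
  shows "(p, q, s, t) = (1, 2, 1, 0) \<or> (p, q, s, t) = (1, 0, 1, 2)"
proof -
  let ?V = "beatty_seq (sqrt 2) p q r" and ?W = "beatty_seq (sqrt 2) s t u"
  have compl: "complementary ?V ?W"
    and V: "strict_mono_on {1..} ?V" and W: "strict_mono_on {1..} ?W"
    using sol by (simp_all add: increasing_solution_def complementary_pair_solution_def)
  \<comment> \<open>The floors 1, 2, 4 at indices 1, 2, 3 exhibit both increments of each
    sequence.\<close>
  have "?V 1 < ?V 2" "?V 2 < ?V 3" by (intro strict_mono_onD[OF V]; simp)+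
  moreover have "?W 1 < ?W 2" "?W 2 < ?W 3" by (intro strict_mono_onD[OF W]; simp)+
  ultimately have inc: "p + q \<ge> 1" "2 * p + q \<ge> 1" "s + t \<ge> 1" "2 * s + t \<ge> 1"
    unfolding beatty_seq_sqrt2_values by linarith+
  define x where "x = of_int p * sqrt 2 + of_int q"
  define y where "y = of_int s * sqrt 2 + of_int t"
  have xy: "(x - 1) * (y - 1) = 1"
    unfolding x_def y_def by (rule complementary_slopes[OF compl V W])
  have "\<not> (x > 2 \<and> y > 2)"
  proof
    assume "x > 2 \<and> y > 2"
    then have "1 * 1 < (x - 1) * (y - 1)" by (intro mult_strict_mono) auto
    then show False using xy by simp
  qed
  then have one: "s + t = 1 \<or> 2 * s + t = 1 \<or> p + q = 1 \<or> 2 * p + q = 1"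
    using slope_gt_2[OF assms(1), of q] slope_gt_2[OF assms(2), of t] inc
    unfolding x_def y_def by linarith
  have "of_int (2 * p * s + q * t - q - t) + of_int (p * t + q * s - p - s) * sqrt 2 = 0"
    using xy unfolding x_def y_def by (simp add: algebra_simps)
  from sqrt2_combination_eq_0[OF this]
  have e: "p + s = p * t + q * s" "q + t = 2 * p * s + q * t" by linarith+
  \<comment> \<open>The system is symmetric in the two sequences, so an increment 1 of
    \<open>V\<close> is treated by the same lemma with the roles exchanged.\<close>
  then have e': "s + p = s * q + t * p" "t + q = 2 * s * p + t * q"
    by (simp_all add: algebra_simps)
  show ?thesis
  proof (cases "s + t = 1 \<or> 2 * s + t = 1")
    case True
    from slopes_of_increment_1[OF assms(2) inc(1) this e] show ?thesis by simp
  next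
    case False
    then have "p + q = 1 \<or> 2 * p + q = 1" using one by blast
    from slopes_of_increment_1[OF assms(1) inc(3) this e'] show ?thesis by simp
  qed
qed

theorem theorem12:
  fixes p q r s t u :: int
  assumes "p \<noteq> 0" and "s \<noteq> 0"
  shows "increasing_solution (sqrt 2) (p, q, r, s, t, u) \<and> beatty_seq (sqrt 2) p q r 1 = 1
    \<longleftrightarrow> (p, q, r, s, t, u) = (1, 0, 0, 1, 2, 0)"
proof
  assume "(p, q, r, s, t, u) = (1, 0, 0, 1, 2, 0)"
  then show "increasing_solution (sqrt 2) (p, q, r, s, t, u) \<and> beatty_seq (sqrt 2) p q r 1 = 1"
    using sqrt2_solution beatty_seq_sqrt2_values(1)[of 1 0 0] by simp
next
  assume sol: "increasing_solution (sqrt 2) (p, q, r, s, t, u) \<and> beatty_seq (sqrt 2) p q r 1 = 1"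
  let ?V = "beatty_seq (sqrt 2) p q r" and ?W = "beatty_seq (sqrt 2) s t u"
  have compl: "complementary ?V ?W"
    and V: "strict_mono_on {1..} ?V" and W: "strict_mono_on {1..} ?W"
    using sol by (simp_all add: increasing_solution_def complementary_pair_solution_def)
  note c = compl[unfolded complementary_def]
  have disj: "?V i \<noteq> ?W j" if "i \<ge> 1" "j \<ge> 1" for i j
    using compl that unfolding complementary_def by fastforce
  have V1: "p + q + r = 1" using sol unfolding beatty_seq_sqrt2_values by simp
  \<comment> \<open>Any positive integer omitted by \<open>V\<close> is a term of \<open>W\<close>,
    so a gap of \<open>V\<close> bounds \<open>W 1\<close> from above and thereby helps to determine
    \<open>u\<close>.\<close>
  have first: "?W 1 \<le> k" if "k > 0" "k \<notin> ?V ` {1..}" for k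
  proof -
    have "k \<in> ?W ` {1..}" using c that by blast
    then show ?thesis using strict_mono_on_leD[OF W] by auto
  qed
  have between: "k \<notin> ?V ` {1..}" if "?V i < k" "k < ?V (Suc i)" "i \<ge> 1" for i k
  proof
    assume "k \<in> ?V ` {1..}"
    then obtain j where "j \<ge> 1" "k = ?V j" by auto
    moreover from this that have "i < j" "j < Suc i"
      using strict_mono_on_leD[OF V, of j i] strict_mono_on_leD[OF V, of "Suc i" j] by fastforce+
    ultimately show False by simp
  qed
  note vals = beatty_seq_sqrt2_values
  consider "(p, q, s, t) = (1, 2, 1, 0)" | "(p, q, s, t) = (1, 0, 1, 2)"
    using sqrt2_solution_slopes[OF assms] sol by blast
  then show "(p, q, r, s, t, u) = (1, 0, 0, 1, 2, 0)"
  proof cases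
    case 1
    text \<open>Here \<open>V\<close> starts with 1, 4, 8, forcing \<open>W\<close> to start with 2, and then \<open>W 5 = 8 = V 3\<close>.\<close>
    then have r: "r = - 2" using V1 by simp
    have "2 \<notin> ?V ` {1..}" by (rule between[of 1]) (use 1 r vals in \<open>simp_all add: numeral_2_eq_2[symmetric]\<close>)
    then have "?W 1 \<le> 2" by (intro first) auto
    moreover have "?W 1 > 0" "?W 1 \<noteq> 1" using c disj[of 1 1] sol by auto
    ultimately have "u = 1" using 1 unfolding vals by simp
    then have "?V 3 = ?W 5" using 1 r unfolding vals by simp
    then show ?thesis using disj[of 3 5] by simp
  next
    case 2
    text \<open>Here \<open>V\<close> starts with 1, 2, 4, so \<open>W\<close> must start with 3.\<close>
    then have r: "r = 0" using V1 by simp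
    have "3 \<notin> ?V ` {1..}" by (rule between[of 2]) (use 2 r vals in \<open>simp_all add: numeral_3_eq_3[symmetric]\<close>)
    then have "?W 1 \<le> 3" by (intro first) auto
    moreover have "?W 1 > 0" "?W 1 \<noteq> 1" using c disj[of 1 1] sol by auto
    moreover have "?W 1 \<noteq> 2" using disj[of 2 1] 2 r unfolding vals by simp
    ultimately have "u = 0" using 2 unfolding vals by simp
    then show ?thesis using 2 r by simp
  qed
qed

end
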